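(* Let $\mathcal{C},\mathcal{C}'\subseteq\mathbb{F}_2((z))^n$ be two one-dimensional convolutional codes over $\mathbb{F}_2$ such that $\bar{\Lambda}(\mathcal{C})=\bar{\Lambda}(\mathcal{C}')$ (equality of generalized adjacency matrices; in particular the two codes have the same overall constraint length). Then $\mathcal{C}$ and $\mathcal{C}'$ are monomially equivalent.
   Context: Let $\mathbb{F}$ be a finite field with $q$ elements (here $\mathbb{F}=\mathbb{F}_2$, $q=2$). **Codes.** A matrix $G\in\mathbb{F}[z]^{k\times n}$ is *basic* if it has a right inverse in $\mathbb{F}[z]^{n\times k}$. A *convolutional code* of dimension $k$ is a subspace $\mathcal{C}=\operatorname{im}G=\{uG\mid u\in\mathbb{F}((z))^k\}$ of $\mathbb{F}((z))^n$ with $G\in\mathbb{F}[z]^{k\times n}$ basic; such a $G$ is called a *generator matrix*. The *overall constraint length* of $\mathcal{C}$ is the maximal degree of the $k\times k$ minors of $G$; it depends only on $\mathcal{C}$. A generator matrix is *minimal* if the sum of its row degrees (the degree of a row being the maximal degree of its entries) equals the overall constraint length. Every code has a minimal generator matrix. **Controller canonical form.** Let $G=(g_{ij})\in\mathbb{F}[z]^{k\times n}$ be a minimal generator matrix with row degrees $\gamma_1,\dots,\gamma_k$, $\gamma=\sum_i\gamma_i$, and $g_{ij}=\sum_{\nu=0}^{\gamma_i}g_{ij}^{(\nu)}z^\nu$. For each $i$ let $A_i\in\mathbb{F}^{\gamma_i\times\gamma_i}$ have ones on the first superdiagonal and zeros elsewhere, $B_i=(1,0,\dots,0)\in\mathbb{F}^{1\times\gamma_i}$,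 and let $C_i\in\mathbb{F}^{\gamma_i\times n}$ have $\nu$-th row $(g_{i1}^{(\nu)},\dots,g_{in}^{(\nu)})$, $\nu=1,\dots,\gamma_i$. Put $A=\operatorname{diag}(A_1,\dots,A_k)\in\mathbb{F}^{\gamma\times\gamma}$, $B=\operatorname{diag}(B_1,\dots,B_k)\in\mathbb{F}^{k\times\gamma}$ (block diagonal), let $C\in\mathbb{F}^{\gamma\times n}$ be $C_1,\dots,C_k$ stacked, and $D=(g_{ij}^{(0)})\in\mathbb{F}^{k\times n}$. If $\gamma_i=0$, the corresponding blocks are missing and the $i$-th row of $B$ is zero. **Adjacency matrix.** Let $s=q^\gamma$ and order the state space $\mathbb{F}^\gamma=\{X_0,\dots,X_{s-1}\}$ (row vectors) with $X_0=0$. With $\operatorname{wt}$ the Hamming weight on $\mathbb{F}^n$, for $i,j\in\{0,\dots,s-1\}$ and $\alpha\in\{0,\dots,n\}$ put $\lambda_{i,j}^{(\alpha)}=\#\{u\in\mathbb{F}^k\mid X_j=X_iA+uB,\ \operatorname{wt}(X_iC+uD)=\alpha\}$, except that $\lambda_{0,0}^{(0)}:=0$. The adjacency matrix of $G$ is $\Lambda_G=\big(\sum_{\alpha=0}^n\lambda_{i,j}^{(\alpha)}W^\alpha\big)_{i,j=0,\dots,s-1}\in\mathbb{Q}[W]^{s\times s}$. If $\gamma=0$ (block code) the state space is $\{0\}$ and $\Lambda_G=\sum_{u\in\mathbb{F}^k\setminus\{0\}}W^{\operatorname{wt}(uD)}$ is a $1\times1$ matrix. **Generalized adjacency matrix.**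 Let $\mathcal{G}$ be the group of permutation matrices $\Pi\in GL_s(\mathbb{Q})$ with $\Pi_{0,0}=1$ (indices running from $0$ to $s-1$). For $\Lambda\in\mathbb{Q}[W]^{s\times s}$ put $\overline{\Lambda}=\{\Pi\Lambda\Pi^{-1}\mid\Pi\in\mathcal{G}\}$. The generalized adjacency matrix of $\mathcal{C}$ is $\bar{\Lambda}(\mathcal{C}):=\overline{\Lambda_G}$ for any minimal generator matrix $G$ of $\mathcal{C}$ and any ordering of states with $X_0=0$; it does not depend on these choices. **Monomial equivalence.** Two matrices $G,G'\in\mathbb{F}[z]^{k\times n}$ are monomially equivalent if $G'=GPR$ for some permutation matrix $P\in GL_n(\mathbb{F})$ and some non-singular diagonal matrix $R\in GL_n(\mathbb{F})$. Two codes are monomially equivalent if they have monomially equivalent generator matrices. *)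

theory Defs
  imports
    "HOL-Library.Z2"
    "HOL-Library.Cardinality"
    "HOL-Computational_Algebra.Formal_Laurent_Series"
    "HOL-Computational_Algebra.Polynomial_FPS"
    "Jordan_Normal_Form.Determinant"
    "Jordan_Normal_Form.DL_Submatrix"
begin

text \<open>
  The field with two elements is the library type \<^typ>\<open>bit\<close>; it lacks a \<^class>\<open>finite\<close> instance.
  All indices start at 0. A row vector is a \<^type>\<open>vec\<close>, acting on matrices from the left by
  \<open>v A = A\<^sup>T v\<close>.
\<close>

instance bit :: finite
proof
  have "(UNIV :: bit set) = {0, 1}" by auto
  then show "finite (UNIV :: bit set)" by (metis finite.emptyI finite.insertI)
qed

definition row_mult :: "'a :: comm_semiring_0 vec \<Rightarrow> 'a mat \<Rightarrow> 'a vec" where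
  "row_mult v A = transpose_mat A *\<^sub>v v"

definition hamming_wt :: "'a :: zero vec \<Rightarrow> nat" where
  "hamming_wt v = card {j. j < dim_vec v \<and> v $ j \<noteq> 0}"

definition perm_mat :: "nat \<Rightarrow> (nat \<Rightarrow> nat) \<Rightarrow> 'a :: zero_neq_one mat" where
  "perm_mat n p = mat n n (\<lambda>(i, j). if i = p j then 1 else 0)"

definition perm_mats :: "nat \<Rightarrow> 'a :: zero_neq_one mat set" where
  "perm_mats n = {perm_mat n p | p. p permutes {..<n}}"


section \<open>Convolutional codes\<close>

definition basic_mat :: "'a :: field poly mat \<Rightarrow> bool" where
  "basic_mat G \<longleftrightarrow> (\<exists>H \<in> carrier_mat (dim_col G) (dim_row G). G * H = 1\<^sub>m (dim_row G))"

definition laurent_of_poly :: "'a :: field poly \<Rightarrow> 'a fls" where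
  "laurent_of_poly p = fps_to_fls (fps_of_poly p)"

definition code_im :: "'a :: field poly mat \<Rightarrow> 'a fls vec set" where
  "code_im G = {row_mult u (map_mat laurent_of_poly G) | u. u \<in> carrier_vec (dim_row G)}"

definition generator_matrix ::
    "nat \<Rightarrow> nat \<Rightarrow> 'a :: field poly mat \<Rightarrow> 'a fls vec set \<Rightarrow> bool" where
  "generator_matrix k n G C \<longleftrightarrow> G \<in> carrier_mat k n \<and> basic_mat G \<and> C = code_im G"

definition convolutional_code :: "nat \<Rightarrow> nat \<Rightarrow> 'a :: field fls vec set \<Rightarrow> bool" where
  "convolutional_code k n C \<longleftrightarrow> (\<exists>G. generator_matrix k n G C)"

definition constraint_length :: "'a :: field poly mat \<Rightarrow> nat" where
  "constraint_length G =
     Max {degree (det (submatrix G UNIV J)) | J. J \<subseteq> {..<dim_col G} \<and> card J = dim_row G}"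

definition row_degree :: "'a :: field poly mat \<Rightarrow> nat \<Rightarrow> nat" where
  "row_degree G i = Max {degree (G $$ (i, j)) | j. j < dim_col G}"

definition total_degree :: "'a :: field poly mat \<Rightarrow> nat" where
  "total_degree G = (\<Sum>i < dim_row G. row_degree G i)"

definition minimal_generator_matrix ::
    "nat \<Rightarrow> nat \<Rightarrow> 'a :: field poly mat \<Rightarrow> 'a fls vec set \<Rightarrow> bool" where
  "minimal_generator_matrix k n G C \<longleftrightarrow>
     generator_matrix k n G C \<and> total_degree G = constraint_length G"


section \<open>Controller canonical form\<close>

definition ccf_A :: "'a :: field poly mat \<Rightarrow> 'a mat" where
  "ccf_A G = diag_block_mat
     (map (\<lambda>i. mat (row_degree G i) (row_degree G i) (\<lambda>(r, c). if c = Suc r then 1 else 0))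
       [0..<dim_row G])"

text \<open>
  A row of \<open>G\<close> of degree 0 contributes a block of size \<open>1 \<times> 0\<close> to \<open>B\<close>, that is, a zero row.
\<close>

definition ccf_B :: "'a :: field poly mat \<Rightarrow> 'a mat" where
  "ccf_B G = diag_block_mat
     (map (\<lambda>i. mat 1 (row_degree G i) (\<lambda>(r, c). if c = 0 then 1 else 0)) [0..<dim_row G])"

definition ccf_C :: "'a :: field poly mat \<Rightarrow> 'a mat" where
  "ccf_C G = foldr (@\<^sub>r)
     (map (\<lambda>i. mat (row_degree G i) (dim_col G) (\<lambda>(r, j). coeff (G $$ (i, j)) (Suc r)))
       [0..<dim_row G])
     (0\<^sub>m 0 (dim_col G))"

definition ccf_D :: "'a :: field poly mat \<Rightarrow> 'a mat" where
  "ccf_D G = map_mat (\<lambda>g. coeff g 0) G"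


section \<open>Adjacency matrices\<close>

definition num_states :: "'a :: {field,finite} poly mat \<Rightarrow> nat" where
  "num_states G = CARD('a) ^ total_degree G"

definition state_ordering :: "'a :: {field,finite} poly mat \<Rightarrow> (nat \<Rightarrow> 'a vec) \<Rightarrow> bool" where
  "state_ordering G X \<longleftrightarrow>
     bij_betw X {..<num_states G} (carrier_vec (total_degree G)) \<and> X 0 = 0\<^sub>v (total_degree G)"

definition transition_count ::
    "'a :: {field,finite} poly mat \<Rightarrow> (nat \<Rightarrow> 'a vec) \<Rightarrow> nat \<Rightarrow> nat \<Rightarrow> nat \<Rightarrow> nat" where
  "transition_count G X i j \<alpha> =
     (if i = 0 \<and> j = 0 \<and> \<alpha> = 0 then 0
      else card {u \<in> carrier_vec (dim_row G).
             X j = row_mult (X i) (ccf_A G) + row_mult u (ccf_B G) \<and>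
             hamming_wt (row_mult (X i) (ccf_C G) + row_mult u (ccf_D G)) = \<alpha>})"

text \<open>
  If \<open>\<gamma> = 0\<close>, the only state is the empty vector, and for basic \<open>G\<close> only \<open>u = 0\<close> satisfies
  \<open>u D = 0\<close>; so the entry below is the sum of \<open>W ^ wt (u D)\<close> over all \<open>u \<noteq> 0\<close>, as
  required for block codes.
\<close>

definition adjacency_matrix ::
    "'a :: {field,finite} poly mat \<Rightarrow> (nat \<Rightarrow> 'a vec) \<Rightarrow> rat poly mat" where
  "adjacency_matrix G X = mat (num_states G) (num_states G)
     (\<lambda>(i, j). \<Sum>\<alpha> \<le> dim_col G. monom (of_nat (transition_count G X i j \<alpha>)) \<alpha>)"

definition state_perm_group :: "nat \<Rightarrow> rat mat set" where
  "state_perm_group s = {P \<in> perm_mats s. P $$ (0, 0) = 1}"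

text \<open>
  In \<^prop>\<open>similar_mat_wit M L P Q\<close> the matrix \<open>Q\<close> is the two-sided inverse of \<open>P\<close>, and \<open>M = P L Q\<close>.
\<close>

definition perm_class :: "rat poly mat \<Rightarrow> rat poly mat set" where
  "perm_class L =
     {M. \<exists>P \<in> state_perm_group (dim_row L). \<exists>Q.
           similar_mat_wit M L (map_mat (\<lambda>c. [:c:]) P) Q}"

text \<open>
  The class is the same for every minimal generator matrix of \<open>C\<close> and every ordering of the states,
  so \<open>SOME\<close> selects the only possible value.
\<close>

definition gen_adjacency_matrix ::
    "nat \<Rightarrow> nat \<Rightarrow> 'a :: {field,finite} fls vec set \<Rightarrow> rat poly mat set" where
  "gen_adjacency_matrix k n C =
     (SOME L. \<exists>G X. minimal_generator_matrix k n G C \<and> state_ordering G X \<and>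
                     L = perm_class (adjacency_matrix G X))"


section \<open>Monomial equivalence\<close>

definition monomially_equivalent_mats :: "'a :: field poly mat \<Rightarrow> 'a poly mat \<Rightarrow> bool" where
  "monomially_equivalent_mats G G' \<longleftrightarrow>
     (\<exists>P \<in> perm_mats (dim_col G). \<exists>R \<in> carrier_mat (dim_col G) (dim_col G).
        diagonal_mat R \<and> invertible_mat R \<and>
        G' = G * map_mat (\<lambda>c. [:c:]) P * map_mat (\<lambda>c. [:c:]) R)"

definition monomially_equivalent ::
    "nat \<Rightarrow> nat \<Rightarrow> 'a :: field fls vec set \<Rightarrow> 'a fls vec set \<Rightarrow> bool" where
  "monomially_equivalent k n C C' \<longleftrightarrow>
     (\<exists>G G'. generator_matrix k n G C \<and> generator_matrix k n G' C' \<and>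
              monomially_equivalent_mats G G')"

end

theory Submission
  imports Defs "Berlekamp_Zassenhaus.Berlekamp_Type_Based"
begin

text \<open>
  For a single generator row the state graph is the shift register (de Bruijn) graph on
  \<open>\<bbbF>\<^sub>2\<^sup>\<gamma>\<close>. Its only automorphism fixing the zero state is the identity: the
  newest symbol of a state vanishes iff the zero state can be reached in \<open>\<gamma> - 1\<close> steps, so newest
  symbols are preserved, and a state is determined by a predecessor and its newest symbol. Hence the two
  generators give the same output weight for every state and input, that is, the two
  \<open>(\<gamma> + 1) \<times> n\<close> coefficient matrices assign the same weight to every message. By the
  MacWilliams argument (orthogonality of the characters of \<open>\<bbbF>\<^sub>2\<^sup>\<gamma>\<^sup>+\<^sup>1\<close>) their columns agree up
  to a permutation.
\<close>

section \<open>Equal weights force equal columns\<close>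

lemma card_bit: "CARD(bit) = 2"
proof -
  have "(UNIV :: bit set) = {0, 1}" by auto
  then have "CARD(bit) = card {0, 1 :: bit}"
    by (rule arg_cong)
  then show ?thesis by simp
qed

text \<open>The nontrivial character of the additive group of the field with two elements.\<close>

definition bit_sign :: "bit \<Rightarrow> int" where
  "bit_sign b = (if b = 0 then 1 else - 1)"

lemma bit_sign_add: "bit_sign (a + b) = bit_sign a * bit_sign b"
  by (cases a; cases b) (simp_all add: bit_sign_def)

text \<open>Orthogonality of characters: if \<open>d\<close> has a nonzero entry at
  \<open>i\<close>, translation by the \<open>i\<close>-th unit vector permutes the messages and
  flips every sign, so the sum equals its own negative.\<close>

lemma sum_bit_sign_scalar_prod:
  assumes d: "d \<in> carrier_vec m"
  shows "(\<Sum>v\<in>carrier_vec m. bit_sign (v \<bullet> d)) = (if d = 0\<^sub>v m then 2 ^ m else 0)"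
proof (cases "d = 0\<^sub>v m")
  case True
  have "bit_sign (v \<bullet> d) = 1" if "v \<in> carrier_vec m" for v
    using that True by (simp add: bit_sign_def)
  then show ?thesis
    using True by (simp add: card_carrier_vec card_bit)
next
  case False
  then obtain i where i: "i < m" "d $ i \<noteq> 0"
    using d by (metis eq_vecI carrier_vecD index_zero_vec)
  let ?t = "\<lambda>v :: bit vec. v + unit_vec m i"
  have invol: "?t (?t v) = v" if "v \<in> carrier_vec m" for v :: "bit vec"
    using that by (intro eq_vecI) (auto simp: add.assoc)
  have bij: "bij_betw ?t (carrier_vec m) (carrier_vec m)"
    by (rule bij_betw_byWitness[where f' = ?t]) (use invol in \<open>auto simp del: assoc_add_vec\<close>)
  have flip: "bit_sign (?t v \<bullet> d) = - bit_sign (v \<bullet> d)" if "v \<in> carrier_vec m" for v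
  proof -
    have "?t v \<bullet> d = v \<bullet> d + d $ i"
      using that d i by (simp add: add_scalar_prod_distrib[of _ m] scalar_prod_left_unit)
    then show ?thesis
      using i by (simp add: bit_sign_add) (simp add: bit_sign_def)
  qed
  have "(\<Sum>v\<in>carrier_vec m. bit_sign (v \<bullet> d)) = (\<Sum>v\<in>carrier_vec m. bit_sign (?t v \<bullet> d))"
    using sum.reindex_bij_betw[OF bij, of "\<lambda>v. bit_sign (v \<bullet> d)"] by simp
  also have "\<dots> = - (\<Sum>v\<in>carrier_vec m. bit_sign (v \<bullet> d))"
    by (simp add: flip sum_negf)
  finally show ?thesis
    using False by simp
qed

text \<open>\<open>c\<close> lists the columns of a matrix, so \<open>v \<bullet> c j\<close> is the
  \<open>j\<close>-th letter of the codeword of the message \<open>v\<close>.\<close>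

definition codeword_wt :: "nat \<Rightarrow> (nat \<Rightarrow> bit vec) \<Rightarrow> bit vec \<Rightarrow> nat" where
  "codeword_wt n c v = card {j. j < n \<and> v \<bullet> c j \<noteq> 0}"

lemma codeword_wt_le: "codeword_wt n c v \<le> n"
  unfolding codeword_wt_def by (rule order_trans[OF card_mono[of "{..<n}"]]) auto

lemma sum_bit_sign_eq:
  "(\<Sum>j<n. bit_sign (v \<bullet> c j)) = int n - 2 * int (codeword_wt n c v)"
proof -
  have "(\<Sum>j<n. bit_sign (v \<bullet> c j)) = (\<Sum>j<n. 1 - 2 * (if v \<bullet> c j \<noteq> 0 then 1 else 0))"
    by (rule sum.cong) (auto simp: bit_sign_def)
  also have "\<dots> = int n - 2 * (\<Sum>j<n. if v \<bullet> c j \<noteq> 0 then 1 else 0)"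
    by (simp add: sum_subtractf sum_distrib_left)
  also have "(\<Sum>j<n. if v \<bullet> c j \<noteq> 0 then 1 else 0) = int (codeword_wt n c v)"
    by (simp add: codeword_wt_def sum.If_cases Int_def)
  finally show ?thesis .
qed

text \<open>Fourier inversion: the multiplicity of a column is recovered from the codeword weights.\<close>

lemma card_column_eq:
  assumes c: "\<And>j. j < n \<Longrightarrow> c j \<in> carrier_vec m" and d: "d \<in> carrier_vec m"
  shows "2 ^ m * int (card {j. j < n \<and> c j = d}) =
    (\<Sum>v\<in>carrier_vec m. bit_sign (v \<bullet> d) * (int n - 2 * int (codeword_wt n c v)))"
proof -
  \<comment> \<open>In characteristic 2 a sum is also a difference, so the character at
    \<open>c j + d\<close> is trivial exactly for the columns equal to \<open>d\<close>.\<close>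
  have eq: "c j + d = 0\<^sub>v m \<longleftrightarrow> c j = d" if "j < n" for j
  proof
    assume "c j + d = 0\<^sub>v m"
    then have "c j $ i + d $ i = 0" if "i < m" for i
      using that d by (metis carrier_vecD index_add_vec(1) index_zero_vec(1))
    then have "c j $ i = d $ i" if "i < m" for i
      using that by (cases "c j $ i"; cases "d $ i") fastforce+
    then show "c j = d"
      using c[OF that] d by (intro eq_vecI) auto
  next
    assume "c j = d"
    then show "c j + d = 0\<^sub>v m"
      using d by (intro eq_vecI) auto
  qed
  \<comment> \<open>The weight is turned back into a sum of signed letters; multiplicativity of the
    sign then merges the two factors into one character.\<close>
  have "(\<Sum>v\<in>carrier_vec m. bit_sign (v \<bullet> d) * (int n - 2 * int (codeword_wt n c v)))
      = (\<Sum>v\<in>carrier_vec m. \<Sum>j<n. bit_sign (v \<bullet> (c j + d)))"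
    unfolding sum_bit_sign_eq[symmetric] sum_distrib_left
    by (intro sum.cong refl)
      (use c d in \<open>simp only: scalar_prod_add_distrib[of _ m] bit_sign_add mult.commute lessThan_iff\<close>)
  also have "\<dots> = (\<Sum>j<n. \<Sum>v\<in>carrier_vec m. bit_sign (v \<bullet> (c j + d)))"
    by (rule sum.swap)
  also have "\<dots> = (\<Sum>j<n. if c j = d then 2 ^ m else 0)"
    by (intro sum.cong refl) (use c d eq in \<open>simp add: sum_bit_sign_scalar_prod\<close>)
  also have "\<dots> = 2 ^ m * int (card {j. j < n \<and> c j = d})"
    by (simp add: sum.If_cases Int_def)
  finally show ?thesis by simp
qed

text \<open>Equal fibre sizes mean that the two lists of values agree as multisets, hence are
  rearrangements of each other.\<close>

lemma permutation_of_card_fibres_eq: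
  fixes n :: nat and f g :: "nat \<Rightarrow> 'a"
  assumes "\<And>d. card {j. j < n \<and> f j = d} = card {j. j < n \<and> g j = d}"
  obtains p where "p permutes {..<n}" "\<And>j. j < n \<Longrightarrow> g j = f (p j)"
proof -
  have "count (mset (map h [0..<n])) d = card {j. j < n \<and> h j = d}" for h :: "nat \<Rightarrow> 'a" and d
  proof -
    have "count (mset (map h [0..<n])) d = card (h -` {d} \<inter> {0..<n})"
      by (simp add: count_image_mset)
    also have "h -` {d} \<inter> {0..<n} = {j. j < n \<and> h j = d}"
      by auto
    finally show ?thesis .
  qed
  then have "mset (map g [0..<n]) = mset (map f [0..<n])"
    by (intro multiset_eqI) (simp only: assms)
  then obtain p where p: "p permutes {..<n}" "permute_list p (map f [0..<n]) = map g [0..<n]"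
    by (metis mset_eq_permutation length_map length_upt diff_zero)
  show thesis
  proof (rule that[OF p(1)])
    fix j assume j: "j < n"
    then have "p j < n"
      using p(1) permutes_in_image by fastforce
    with j arg_cong[OF p(2), of "\<lambda>xs. xs ! j"] show "g j = f (p j)"
      using p(1) by (simp add: permute_list_nth)
  qed
qed

text \<open>The inversion formula sees the columns only through the weights, so every vector occurs
  equally often among both families of columns.\<close>

lemma permutation_of_codeword_wt_eq:
  assumes c: "\<And>j. j < n \<Longrightarrow> c j \<in> carrier_vec m" and c': "\<And>j. j < n \<Longrightarrow> c' j \<in> carrier_vec m"
    and wt: "\<And>v. v \<in> carrier_vec m \<Longrightarrow> codeword_wt n c v = codeword_wt n c' v"
  obtains p where "p permutes {..<n}" "\<And>j. j < n \<Longrightarrow> c' j = c (p j)"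
proof -
  have "card {j. j < n \<and> c j = d} = card {j. j < n \<and> c' j = d}" for d
  proof (cases "d \<in> carrier_vec m")
    case True
    have "2 ^ m * int (card {j. j < n \<and> c j = d}) =
        (\<Sum>v\<in>carrier_vec m. bit_sign (v \<bullet> d) * (int n - 2 * int (codeword_wt n c v)))"
      by (rule card_column_eq[where c = c and n = n]) (fact c True)+
    also have "\<dots> =
        (\<Sum>v\<in>carrier_vec m. bit_sign (v \<bullet> d) * (int n - 2 * int (codeword_wt n c' v)))"
      by (simp add: wt)
    also have "\<dots> = 2 ^ m * int (card {j. j < n \<and> c' j = d})"
      by (rule card_column_eq[where c = c' and n = n, symmetric]) (fact c' True)+
    finally have "2 ^ m * int (card {j. j < n \<and> c j = d}) = 2 ^ m * int (card {j. j < n \<and> c' j = d})" .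
    then show ?thesis by simp
  next
    case False
    then have "{j. j < n \<and> c j = d} = {}" "{j. j < n \<and> c' j = d} = {}"
      using c c' by auto
    then show ?thesis by (simp only:)
  qed
  then show thesis
    by (rule permutation_of_card_fibres_eq) (rule that)
qed

section \<open>Rigidity of the shift register graph\<close>

text \<open>A state holds its newest symbol at index 0. The step drops the oldest symbol of
  \<open>x\<close> and leaves \<open>y $ 0\<close> free, since that is the input.\<close>

definition shift_edge :: "nat \<Rightarrow> bit vec \<Rightarrow> bit vec \<Rightarrow> bool" where
  "shift_edge m x y \<longleftrightarrow> (\<forall>i. Suc i < m \<longrightarrow> y $ Suc i = x $ i)"

lemma shift_automorphism_eq_id:
  fixes \<sigma> :: "bit vec \<Rightarrow> bit vec"
  assumes bij: "bij_betw \<sigma> (carrier_vec m) (carrier_vec m)"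
    and zero: "\<sigma> (0\<^sub>v m) = 0\<^sub>v m"
    and edge: "\<And>x y. x \<in> carrier_vec m \<Longrightarrow> y \<in> carrier_vec m \<Longrightarrow>
      shift_edge m x y \<longleftrightarrow> shift_edge m (\<sigma> x) (\<sigma> y)"
    and x: "x \<in> carrier_vec m"
  shows "\<sigma> x = x"
proof -
  have \<sigma>: "\<sigma> x \<in> carrier_vec m" if "x \<in> carrier_vec m" for x
    using bij that by (auto simp: bij_betw_def)
  \<comment> \<open>The states from which the zero state can be reached in \<open>k\<close> steps.\<close>
  define Z where "Z k = {x :: bit vec. x \<in> carrier_vec m \<and> (\<forall>i. i + k < m \<longrightarrow> x $ i = 0)}" for k
  have Z_0: "Z 0 = {0\<^sub>v m}"
    by (auto simp: Z_def)
  have Z_Suc: "x \<in> Z (Suc k) \<longleftrightarrow> (\<exists>y\<in>Z k. shift_edge m x y)" if x: "x \<in> carrier_vec m" for x k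
  proof
    assume "x \<in> Z (Suc k)"
    \<comment> \<open>The witness is the successor of \<open>x\<close> under input 0.\<close>
    then show "\<exists>y\<in>Z k. shift_edge m x y"
      by (intro bexI[of _ "vec m (case_nat 0 (($) x))"])
        (auto simp: Z_def shift_edge_def split: nat.split)
  next
    assume "\<exists>y\<in>Z k. shift_edge m x y"
    then obtain y where "y \<in> Z k" "shift_edge m x y" by blast
    then have "x $ i = 0" if "i + Suc k < m" for i
      using that unfolding Z_def shift_edge_def
      by (metis (mono_tags, lifting) add_Suc add_Suc_right add_lessD1 mem_Collect_eq)
    then show "x \<in> Z (Suc k)"
      using x by (simp add: Z_def)
  qed
  have Z: "x \<in> Z k \<longleftrightarrow> \<sigma> x \<in> Z k" if "x \<in> carrier_vec m" for x k
    using that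
  proof (induction k arbitrary: x)
    case 0
    have "\<sigma> x = 0\<^sub>v m \<longleftrightarrow> x = 0\<^sub>v m"
      using bij zero 0 by (metis bij_betw_imp_inj_on inj_on_def zero_carrier_vec)
    then show ?case by (simp add: Z_0)
  next
    case (Suc k)
    have sub: "Z k \<subseteq> carrier_vec m"
      by (auto simp: Z_def)
    \<comment> \<open>Successors of \<open>\<sigma> x\<close> may be sought in the image of
      \<open>\<sigma>\<close>, which is the whole state space.\<close>
    have "(\<exists>y\<in>Z k. shift_edge m x y) \<longleftrightarrow> (\<exists>y\<in>carrier_vec m. \<sigma> y \<in> Z k \<and> shift_edge m (\<sigma> x) (\<sigma> y))"
      using sub Suc edge by blast
    also have "\<dots> \<longleftrightarrow> (\<exists>y\<in>\<sigma> ` carrier_vec m. y \<in> Z k \<and> shift_edge m (\<sigma> x) y)"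
      by blast
    also have "\<dots> \<longleftrightarrow> (\<exists>y\<in>Z k. shift_edge m (\<sigma> x) y)"
      using sub bij by (auto simp: bij_betw_def)
    finally show ?case
      using Suc.prems by (simp add: Z_Suc \<sigma>)
  qed
  have newest: "\<sigma> x $ 0 = x $ 0" if x: "x \<in> carrier_vec m" and m: "0 < m" for x
  proof -
    \<comment> \<open>Membership in \<open>Z (m - 1)\<close> constrains coordinate 0 alone, and a
      bit is known once it is known whether it vanishes.\<close>
    have at_0: "i + (m - 1) < m \<longleftrightarrow> i = 0" for i
      using m by auto
    have "y \<in> Z (m - 1) \<longleftrightarrow> y $ 0 = 0" if "y \<in> carrier_vec m" for y
      using that by (simp only: Z_def mem_Collect_eq at_0 simp_thms)
    then have "x $ 0 = 0 \<longleftrightarrow> \<sigma> x $ 0 = 0"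
      using Z[OF x] x \<sigma>[OF x] by blast
    then show ?thesis
      by (cases "x $ 0"; cases "\<sigma> x $ 0") auto
  qed
  \<comment> \<open>Induction on the number \<open>k\<close> of leading coordinates that may be
    nonzero; \<open>k = m\<close> covers all states.\<close>
  have "\<sigma> x = x" if "x \<in> carrier_vec m" "\<forall>i<m. k \<le> i \<longrightarrow> x $ i = 0" for k and x :: "bit vec"
    using that
  proof (induction k arbitrary: x)
    case 0
    then have "x = 0\<^sub>v m" by (intro eq_vecI) auto
    then show ?case using zero by simp
  next
    case (Suc k)
    \<comment> \<open>The predecessor of \<open>x\<close> with oldest symbol 0 is supported on the
      first \<open>k\<close> coordinates, so the induction hypothesis fixes it. Its edge to
      \<open>\<sigma> x\<close> determines all coordinates but the newest.\<close>
    define y where "y = vec m (\<lambda>i. if Suc i < m then x $ Suc i else 0)"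
    have y: "y \<in> carrier_vec m" and "\<sigma> y = y"
      using Suc by (auto simp: y_def)
    moreover have "shift_edge m y x"
      by (simp add: shift_edge_def y_def)
    ultimately have shift: "shift_edge m y (\<sigma> x)"
      using edge[of y x] Suc.prems by simp
    show ?case
    proof (rule eq_vecI)
      fix i assume "i < dim_vec x"
      then have i: "i < m" using Suc.prems by simp
      show "\<sigma> x $ i = x $ i"
      proof (cases i)
        case 0
        then show ?thesis using newest Suc.prems i by simp
      next
        case (Suc i')
        then show ?thesis using shift i by (simp add: shift_edge_def y_def)
      qed
    qed (use \<sigma> Suc.prems in auto)
  qed
  from this[of x m] x show ?thesis by simp
qed

section \<open>The state graph of a one-dimensional code\<close>

lemma dim_row_mult [simp]: "dim_vec (row_mult v A) = dim_col A"
  by (simp add: row_mult_def)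

lemma row_mult_index:
  assumes "v \<in> carrier_vec (dim_row A)" "j < dim_col A"
  shows "row_mult v A $ j = (\<Sum>i<dim_row A. v $ i * A $$ (i, j))"
  using assms by (simp add: row_mult_def scalar_prod_def lessThan_atLeast0 mult.commute)

text \<open>Column \<open>j\<close> of the coefficient matrix with \<gamma> + 1 rows obtained by
  placing \<open>ccf_D G\<close> on top of \<open>ccf_C G\<close>.\<close>

definition coeff_col :: "'a :: field poly mat \<Rightarrow> nat \<Rightarrow> 'a vec" where
  "coeff_col G j = vec (Suc (row_degree G 0)) (coeff (G $$ (0, j)))"

definition next_state :: "nat \<Rightarrow> 'a \<Rightarrow> 'a vec \<Rightarrow> 'a vec" where
  "next_state m u x = vec m (case_nat u (($) x))"

lemma total_degree_one_row: "dim_row G = 1 \<Longrightarrow> total_degree G = row_degree G 0"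
  by (simp add: total_degree_def)

text \<open>With one row, \<open>ccf_A G\<close> is a single block with ones above the diagonal: on
  row vectors it moves each symbol one index up, while \<open>ccf_B G\<close> feeds the input into
  index 0.\<close>

lemma ccf_next_state:
  assumes G: "dim_row G = 1" and x: "x \<in> carrier_vec (row_degree G 0)" and u: "u \<in> carrier_vec 1"
  shows "row_mult x (ccf_A G) + row_mult u (ccf_B G) = next_state (row_degree G 0) (u $ 0) x"
proof (rule eq_vecI)
  let ?m = "row_degree G 0"
  have A: "ccf_A G = mat ?m ?m (\<lambda>(r, c). if c = Suc r then 1 else 0)"
    and B: "ccf_B G = mat 1 ?m (\<lambda>(r, c). if c = 0 then 1 else 0)"
    by (simp_all add: ccf_A_def ccf_B_def G del: diag_block_mat.simps)
  show "dim_vec (row_mult x (ccf_A G) + row_mult u (ccf_B G)) = dim_vec (next_state ?m (u $ 0) x)"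
    by (simp add: A B next_state_def)
  fix i assume "i < dim_vec (next_state ?m (u $ 0) x)"
  then have i: "i < ?m" by (simp add: next_state_def)
  have "row_mult x (ccf_A G) $ i = (\<Sum>r<?m. if i = Suc r then x $ r else 0)"
    using x i by (subst row_mult_index) (auto simp: A intro!: sum.cong)
  moreover have "row_mult u (ccf_B G) $ i = (if i = 0 then u $ 0 else 0)"
    using u i by (subst row_mult_index) (auto simp: B)
  ultimately show "(row_mult x (ccf_A G) + row_mult u (ccf_B G)) $ i = next_state ?m (u $ 0) x $ i"
    using i by (cases i) (simp_all add: next_state_def A B)
qed

text \<open>Input and state form one message: the input meets the constant coefficients, state entry
  \<open>r\<close> the coefficients of degree \<open>Suc r\<close>.\<close>

lemma ccf_output:
  assumes G: "dim_row G = 1" and x: "x \<in> carrier_vec (row_degree G 0)" and u: "u \<in> carrier_vec 1"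
  shows "row_mult x (ccf_C G) + row_mult u (ccf_D G) =
    vec (dim_col G) (\<lambda>j. vCons (u $ 0) x \<bullet> coeff_col G j)"
proof (rule eq_vecI)
  let ?m = "row_degree G 0" and ?n = "dim_col G"
  have C: "ccf_C G = mat ?m ?n (\<lambda>(r, j). coeff (G $$ (0, j)) (Suc r))"
    by (rule eq_matI) (auto simp: ccf_C_def G append_rows_def)
  show "dim_vec (row_mult x (ccf_C G) + row_mult u (ccf_D G)) =
      dim_vec (vec ?n (\<lambda>j. vCons (u $ 0) x \<bullet> coeff_col G j))"
    by (simp add: C ccf_D_def)
  fix j assume "j < dim_vec (vec ?n (\<lambda>j. vCons (u $ 0) x \<bullet> coeff_col G j))"
  then have j: "j < ?n" by simp
  have "row_mult x (ccf_C G) $ j = (\<Sum>r<?m. x $ r * coeff (G $$ (0, j)) (Suc r))"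
    using x j by (subst row_mult_index) (auto simp: C)
  moreover have "row_mult u (ccf_D G) $ j = u $ 0 * coeff (G $$ (0, j)) 0"
    using u j G by (subst row_mult_index) (auto simp: ccf_D_def)
  ultimately show "(row_mult x (ccf_C G) + row_mult u (ccf_D G)) $ j =
      vec ?n (\<lambda>j. vCons (u $ 0) x \<bullet> coeff_col G j) $ j"
    using j by (simp add: C ccf_D_def coeff_col_def scalar_prod_def
        sum.atLeast0_lessThan_Suc_shift lessThan_atLeast0 del: sum.op_ivl_Suc)
qed

text \<open>The weighted edges of the state graph without multiplicities. They include the loop of
  weight 0 at the zero state, which the adjacency matrix omits.\<close>

definition transition :: "bit poly mat \<Rightarrow> bit vec \<Rightarrow> bit vec \<Rightarrow> nat \<Rightarrow> bool" where
  "transition G x y a \<longleftrightarrow> (\<exists>u. y = next_state (row_degree G 0) u x \<and>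
     codeword_wt (dim_col G) (coeff_col G) (vCons u x) = a)"

text \<open>The assumption \<open>nz\<close> excludes the one count that is set to 0 by
  convention.\<close>

lemma transition_count_pos_iff:
  assumes G: "dim_row G = 1" and X: "X i \<in> carrier_vec (row_degree G 0)"
    and nz: "\<not> (i = 0 \<and> j = 0 \<and> a = 0)"
  shows "0 < transition_count G X i j a \<longleftrightarrow> transition G (X i) (X j) a"
proof -
  let ?S = "{u \<in> carrier_vec 1. X j = next_state (row_degree G 0) (u $ 0) (X i) \<and>
    codeword_wt (dim_col G) (coeff_col G) (vCons (u $ 0) (X i)) = a}"
  have wt: "hamming_wt (vec (dim_col G) (\<lambda>j. vCons u (X i) \<bullet> coeff_col G j)) =
      codeword_wt (dim_col G) (coeff_col G) (vCons u (X i))" for u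
    unfolding hamming_wt_def codeword_wt_def by (rule arg_cong[of _ _ card]) auto
  have "transition_count G X i j a = card ?S"
    unfolding transition_count_def if_not_P[OF nz] G
    by (intro arg_cong[of _ _ card] Collect_cong conj_cong refl)
      (use G X in \<open>simp_all only: ccf_next_state ccf_output wt\<close>)
  moreover have "finite ?S"
    by (rule finite_subset[OF _ finite_carrier_vec[of 1]]) auto
  moreover have "?S \<noteq> {} \<longleftrightarrow> transition G (X i) (X j) a"
  proof
    assume "transition G (X i) (X j) a"
    then obtain u where "X j = next_state (row_degree G 0) u (X i)"
      "codeword_wt (dim_col G) (coeff_col G) (vCons u (X i)) = a"
      by (auto simp: transition_def)
    then have "vec 1 (\<lambda>_. u) \<in> ?S" by simp
    then show "?S \<noteq> {}" by blast
  qed (auto simp: transition_def)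
  ultimately show ?thesis
    by (simp add: card_gt_0_iff)
qed

section \<open>Entries of adjacency matrices and conjugation by permutation matrices\<close>

lemma coeff_adjacency_matrix:
  assumes "i < num_states G" "j < num_states G" "a \<le> dim_col G"
  shows "coeff (adjacency_matrix G X $$ (i, j)) a = of_nat (transition_count G X i j a)"
  using assms by (simp add: adjacency_matrix_def coeff_sum)

lemma adjacency_matrix_carrier [simp]:
  "adjacency_matrix G X \<in> carrier_mat (num_states G) (num_states G)"
  by (simp add: adjacency_matrix_def)

text \<open>Column \<open>j\<close> of \<open>perm_mat n p\<close> has its single one in row
  \<open>p j\<close>, so multiplication from the right selects column \<open>p j\<close>.\<close>

lemma mult_perm_mat_index:
  fixes A :: "'a :: comm_ring_1 mat"
  assumes "A \<in> carrier_mat m n" "p permutes {..<n}" "i < m" "j < n"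
  shows "(A * perm_mat n p) $$ (i, j) = A $$ (i, p j)"
proof -
  have "p j < n"
    using assms permutes_in_image by fastforce
  moreover have "(A * perm_mat n p) $$ (i, j) = (\<Sum>k\<in>{0..<n}. A $$ (i, k) * (if k = p j then 1 else 0))"
    using assms by (simp add: perm_mat_def scalar_prod_def)
  ultimately show ?thesis by (simp add: if_distrib cong: if_cong)
qed

lemma perm_mat_mult_index:
  fixes A :: "'a :: comm_ring_1 mat"
  assumes "A \<in> carrier_mat n m" "p permutes {..<n}" "i < n" "j < m"
  shows "(perm_mat n p * A) $$ (p i, j) = A $$ (i, j)"
proof -
  have "p i < n"
    using assms permutes_in_image by fastforce
  moreover have "p i = p k \<longleftrightarrow> k = i" for k
    using assms(2) by (metis permutes_inj injD)
  ultimately have "(perm_mat n p * A) $$ (p i, j) = (\<Sum>k\<in>{0..<n}. (if k = i then 1 else 0) * A $$ (k, j))"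
    using assms by (simp add: perm_mat_def scalar_prod_def)
  then show ?thesis using assms by (simp add: if_distrib[of "\<lambda>x. x * _"] cong: if_cong)
qed

lemma map_perm_mat:
  fixes h :: "'a :: zero_neq_one \<Rightarrow> 'b :: zero_neq_one"
  assumes "h 0 = 0" "h 1 = 1"
  shows "map_mat h (perm_mat n p) = perm_mat n p"
  using assms by (intro eq_matI) (auto simp: perm_mat_def)

lemma perm_class_refl:
  assumes "L \<in> carrier_mat s s" "0 < s"
  shows "L \<in> perm_class L"
proof -
  have "perm_mat s id = (1\<^sub>m s :: rat mat)"
    by (intro eq_matI) (auto simp: perm_mat_def)
  then have "1\<^sub>m s \<in> state_perm_group s"
    using assms permutes_id unfolding state_perm_group_def perm_mats_def
    by (auto intro!: exI[of _ id])
  moreover have "map_mat (\<lambda>c. [:c:]) (1\<^sub>m s :: rat mat) = 1\<^sub>m s"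
    by (intro eq_matI) auto
  ultimately show ?thesis
    using assms(1) similar_mat_wit_refl[OF assms(1)] unfolding perm_class_def
    by (auto intro!: bexI[of _ "1\<^sub>m s"] exI[of _ "1\<^sub>m s"])
qed

text \<open>Conjugation by a permutation matrix relabels rows and columns by \<open>p\<close>; the
  corner entry 1 makes \<open>p\<close> fix the index 0.\<close>

lemma perm_class_memE:
  assumes "M \<in> perm_class L"
  obtains s p where "M \<in> carrier_mat s s" "L \<in> carrier_mat s s" "p permutes {..<s}"
    "0 < s \<longrightarrow> p 0 = 0" "\<forall>i<s. \<forall>j<s. M $$ (p i, p j) = L $$ (i, j)"
proof -
  define s where "s = dim_row L"
  obtain P Q where P: "P \<in> state_perm_group s"
    and wit: "similar_mat_wit M L (map_mat (\<lambda>c. [:c:]) P) Q"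
    using assms by (auto simp: perm_class_def s_def)
  from P obtain p where p: "p permutes {..<s}" and Pp: "P = perm_mat s p" and P0: "P $$ (0, 0) = 1"
    by (auto simp: state_perm_group_def perm_mats_def)
  have hom: "map_mat (\<lambda>c. [:c:]) P = (perm_mat s p :: rat poly mat)" (is "_ = ?P")
    unfolding Pp by (rule map_perm_mat) auto
  have "dim_row M = s"
    using similar_mat_witD(5)[OF refl wit] by (simp add: s_def)
  note w = similar_mat_witD[OF this[symmetric] wit, unfolded hom]
  \<comment> \<open>Multiplying by the permutation matrix cancels its inverse \<open>Q\<close> and
    leaves an identity that can be compared entry by entry.\<close>
  have "M * ?P = ?P * L * (Q * ?P)"
    using w(3-7) by (simp add: assoc_mult_mat[of _ s s _ s _ s])
  then have MP: "M * ?P = ?P * L"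
    using w(2,5,6) by simp
  show thesis
  proof (rule that[OF w(4,5) p])
    show "0 < s \<longrightarrow> p 0 = 0"
      using P0 by (auto simp: Pp perm_mat_def split: if_splits)
    show "\<forall>i<s. \<forall>j<s. M $$ (p i, p j) = L $$ (i, j)"
    proof (intro allI impI)
      fix i j assume that: "i < s" "j < s"
      have "p i < s" using p that permutes_in_image by fastforce
      then have "M $$ (p i, p j) = (M * ?P) $$ (p i, j)"
        using mult_perm_mat_index[OF w(4) p] that by simp
      also have "\<dots> = L $$ (i, j)"
        unfolding MP using perm_mat_mult_index[OF w(5) p] that by simp
      finally show "M $$ (p i, p j) = L $$ (i, j)" .
    qed
  qed
qed

section \<open>From equal permutation classes to equal codeword weights\<close>

lemma num_states_pos: "0 < num_states (G :: 'a :: {field, finite} poly mat)"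
  by (simp add: num_states_def)

lemma num_states_bit: "num_states (G :: bit poly mat) = 2 ^ total_degree G"
  by (simp add: num_states_def card_bit)

lemma isomorphic_state_graphs:
  fixes G G' :: "bit poly mat"
  assumes G: "G \<in> carrier_mat 1 n" "state_ordering G X"
    and G': "G' \<in> carrier_mat 1 n" "state_ordering G' X'"
    and eq: "perm_class (adjacency_matrix G X) = perm_class (adjacency_matrix G' X')"
  obtains m \<sigma> where "row_degree G 0 = m" "row_degree G' 0 = m"
    "bij_betw \<sigma> (carrier_vec m) (carrier_vec m)" "\<sigma> (0\<^sub>v m) = 0\<^sub>v m"
    "\<And>x y a. x \<in> carrier_vec m \<Longrightarrow> y \<in> carrier_vec m \<Longrightarrow> a \<le> n \<Longrightarrow>
      \<not> (x = 0\<^sub>v m \<and> y = 0\<^sub>v m \<and> a = 0) \<Longrightarrow> transition G x y a \<longleftrightarrow> transition G' (\<sigma> x) (\<sigma> y) a"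
proof -
  have "adjacency_matrix G' X' \<in> perm_class (adjacency_matrix G X)"
    unfolding eq by (rule perm_class_refl[OF adjacency_matrix_carrier num_states_pos])
  then obtain s p where s: "adjacency_matrix G' X' \<in> carrier_mat s s" "adjacency_matrix G X \<in> carrier_mat s s"
    and p: "p permutes {..<s}" "0 < s \<longrightarrow> p 0 = 0"
      "\<forall>i<s. \<forall>j<s. adjacency_matrix G' X' $$ (p i, p j) = adjacency_matrix G X $$ (i, j)"
    by (rule perm_class_memE) blast
  have sG: "num_states G = s" "num_states G' = s"
    using s by (auto simp: adjacency_matrix_def)
  have s0: "0 < s"
    using num_states_pos[of G] by (simp add: sG)
  define m where "m = row_degree G 0"
  have tG: "total_degree G = m" "total_degree G' = row_degree G' 0"
    using G G' by (auto simp: m_def total_degree_one_row)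
  \<comment> \<open>The common matrix size is 2 to the power of either row degree.\<close>
  have m': "row_degree G' 0 = m"
  proof (rule power_inject_exp[THEN iffD1])
    show "(2 :: nat) ^ row_degree G' 0 = 2 ^ m"
      using sG by (simp add: num_states_bit tG)
  qed simp
  have X: "bij_betw X {..<s} (carrier_vec m)" "X 0 = 0\<^sub>v m"
    and X': "bij_betw X' {..<s} (carrier_vec m)" "X' 0 = 0\<^sub>v m"
    using G(2) G'(2) by (auto simp: state_ordering_def sG tG m')
  define Y where "Y = inv_into {..<s} X"
  have Y: "bij_betw Y (carrier_vec m) {..<s}"
    unfolding Y_def by (rule bij_betw_inv_into[OF X(1)])
  have XY: "X (Y x) = x" "Y x < s" if "x \<in> carrier_vec m" for x
    using that bij_betw_inv_into_right[OF X(1)] bij_betwE[OF Y] by (auto simp: Y_def)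
  have Y0: "Y (0\<^sub>v m) = 0"
    using X s0 unfolding Y_def by (metis bij_betw_inv_into_left lessThan_iff)
  \<comment> \<open>From a state to its index in the first ordering, through \<open>p\<close>, to a
    state in the second ordering.\<close>
  define \<sigma> where "\<sigma> x = X' (p (Y x))" for x
  show thesis
  proof (rule that[of m \<sigma>])
    have "bij_betw (X' \<circ> (p \<circ> Y)) (carrier_vec m) (carrier_vec m)"
      using Y permutes_imp_bij[OF p(1)] X'(1) by (intro bij_betw_trans)
    then show "bij_betw \<sigma> (carrier_vec m) (carrier_vec m)"
      by (simp add: \<sigma>_def[abs_def] o_def)
    show "\<sigma> (0\<^sub>v m) = 0\<^sub>v m"
      by (simp add: \<sigma>_def Y0 p(2) s0 X')
    fix x y :: "bit vec" and a :: nat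
    assume x: "x \<in> carrier_vec m" and y: "y \<in> carrier_vec m" and a: "a \<le> n"
      and nz: "\<not> (x = 0\<^sub>v m \<and> y = 0\<^sub>v m \<and> a = 0)"
    \<comment> \<open>Both orderings start with the zero state and \<open>p\<close> fixes 0, so the
      exceptional entries of the two matrices correspond.\<close>
    have nz1: "\<not> (Y x = 0 \<and> Y y = 0 \<and> a = 0)"
      using nz XY(1)[OF x] XY(1)[OF y] X(2) by auto
    have "p i = 0 \<longleftrightarrow> i = 0" for i
      using p(1,2) s0 by (metis permutes_inj injD)
    then have nz2: "\<not> (p (Y x) = 0 \<and> p (Y y) = 0 \<and> a = 0)"
      using nz1 by simp
    have ps: "p (Y x) < s" "p (Y y) < s"
      using XY(2) x y p(1) permutes_in_image by fastforce+
    have "(of_nat (transition_count G X (Y x) (Y y) a) :: rat) =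
        of_nat (transition_count G' X' (p (Y x)) (p (Y y)) a)"
      using coeff_adjacency_matrix[of "Y x" G "Y y" a X]
        coeff_adjacency_matrix[of "p (Y x)" G' "p (Y y)" a X'] p(3)[rule_format, of "Y x" "Y y"] ps XY(2) x y a G(1) G'(1)
      by (simp add: sG)
    then have "0 < transition_count G X (Y x) (Y y) a \<longleftrightarrow>
        0 < transition_count G' X' (p (Y x)) (p (Y y)) a"
      by simp
    moreover have "X' (p (Y x)) \<in> carrier_vec m"
      using ps X'(1) by (auto simp: bij_betw_def)
    ultimately show "transition G x y a \<longleftrightarrow> transition G' (\<sigma> x) (\<sigma> y) a"
      using transition_count_pos_iff[of G X "Y x" "Y y" a] nz1 transition_count_pos_iff[of G' X' "p (Y x)" "p (Y y)" a] nz2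
        G(1) G'(1) x y by (simp add: XY \<sigma>_def m' flip: m_def)
  qed (simp_all add: m_def m')
qed

text \<open>Weights never exceed \<open>n\<close>, so forgetting them leaves the bare shift
  register; the input realizing an edge is the newest symbol of \<open>y\<close>.\<close>

lemma shift_edge_iff_transition:
  assumes G: "dim_col G = n" "row_degree G 0 = m" and "0 < m"
    and x: "x \<in> carrier_vec m" and y: "y \<in> carrier_vec m"
  shows "shift_edge m x y \<longleftrightarrow> (\<exists>a\<le>n. transition G x y a)"
proof
  assume e: "shift_edge m x y"
  have "y = next_state m (y $ 0) x"
    using e x y by (intro eq_vecI) (auto simp: next_state_def shift_edge_def split: nat.split)
  then show "\<exists>a\<le>n. transition G x y a"
    unfolding transition_def G using codeword_wt_le by blast
qed (auto simp: transition_def G next_state_def shift_edge_def)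

lemma codeword_wt_eq_of_isomorphic:
  assumes G: "dim_col G = n" "row_degree G 0 = m" and G': "dim_col G' = n" "row_degree G' 0 = m"
    and bij: "bij_betw \<sigma> (carrier_vec m) (carrier_vec m)" and zero: "\<sigma> (0\<^sub>v m) = 0\<^sub>v m"
    and iso: "\<And>x y a. x \<in> carrier_vec m \<Longrightarrow> y \<in> carrier_vec m \<Longrightarrow> a \<le> n \<Longrightarrow>
      \<not> (x = 0\<^sub>v m \<and> y = 0\<^sub>v m \<and> a = 0) \<Longrightarrow> transition G x y a \<longleftrightarrow> transition G' (\<sigma> x) (\<sigma> y) a"
    and v: "v \<in> carrier_vec (Suc m)"
  shows "codeword_wt n (coeff_col G) v = codeword_wt n (coeff_col G') v"
proof -
  have \<sigma>: "\<sigma> x \<in> carrier_vec m" if "x \<in> carrier_vec m" for x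
    using bij that by (auto simp: bij_betw_def)
  have id: "\<sigma> x = x" if x: "x \<in> carrier_vec m" for x
  proof (cases "m = 0")
    case True
    then show ?thesis using x \<sigma>[OF x] by (intro eq_vecI) auto
  next
    case False
    show ?thesis
    proof (rule shift_automorphism_eq_id[OF bij zero _ x])
      fix x y :: "bit vec"
      assume x: "x \<in> carrier_vec m" and y: "y \<in> carrier_vec m"
      show "shift_edge m x y \<longleftrightarrow> shift_edge m (\<sigma> x) (\<sigma> y)"
      proof (cases "x = 0\<^sub>v m \<and> y = 0\<^sub>v m")
        \<comment> \<open>At this pair \<open>iso\<close> says nothing about weight 0, but
          \<open>\<sigma>\<close> fixes both states.\<close>
        case True
        then show ?thesis by (simp add: zero)
      next
        case ne: False
        have "shift_edge m x y \<longleftrightarrow> (\<exists>a\<le>n. transition G x y a)"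
          using shift_edge_iff_transition[OF G _ x y] False by simp
        also have "\<dots> \<longleftrightarrow> (\<exists>a\<le>n. transition G' (\<sigma> x) (\<sigma> y) a)"
          using iso[OF x y] ne by blast
        also have "\<dots> \<longleftrightarrow> shift_edge m (\<sigma> x) (\<sigma> y)"
          using shift_edge_iff_transition[OF G' _ \<sigma>[OF x] \<sigma>[OF y]] False by simp
        finally show ?thesis .
      qed
    qed
  qed
  \<comment> \<open>A message is an input followed by a state.\<close>
  obtain u x where v_eq: "v = vCons u x" and x: "x \<in> carrier_vec m"
    using v by (cases v) auto
  let ?w = "codeword_wt n (coeff_col G) (vCons u x)" and ?w' = "codeword_wt n (coeff_col G') (vCons u x)"
  define y where "y = next_state m u x"
  have y: "y \<in> carrier_vec m" by (simp add: y_def next_state_def)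
  \<comment> \<open>For \<open>m = 0\<close> the input is not determined by the two states, but an input of positive
    weight is \<open>1\<close>.\<close>
  have input: "codeword_wt n (coeff_col H) (vCons u x) = a"
    if H: "dim_col H = n" "row_degree H 0 = m" and t: "transition H x y a" and a: "0 < a"
      and u: "0 < codeword_wt n (coeff_col H') (vCons u x)" "row_degree H' 0 = m" for H H' a
  proof -
    obtain u' where u': "y = next_state m u' x" "codeword_wt n (coeff_col H) (vCons u' x) = a"
      using t by (auto simp: transition_def H)
    have "u' = u"
    proof (cases "m = 0")
      case True
      \<comment> \<open>Without memory the input 0 gives the zero codeword under every generator, so
        positive weights force both \<open>u\<close> and \<open>u'\<close> to be 1.\<close>
      then have z: "codeword_wt n (coeff_col K) (vCons 0 x) = 0" if "row_degree K 0 = m" for K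
        using that True by (simp add: codeword_wt_def scalar_prod_def coeff_col_def)
      then have "u' \<noteq> 0" "u \<noteq> 0"
        using u' a u H by force+
      then show ?thesis by simp
    next
      case False
      then show ?thesis
        using arg_cong[OF u'(1), of "\<lambda>y :: bit vec. y $ 0"] by (simp add: y_def next_state_def)
    qed
    then show ?thesis using u' by simp
  qed
  have t: "transition G x y ?w" "transition G' x y ?w'"
    by (auto simp: transition_def G G' y_def)
  have "?w' = ?w" if w: "0 < ?w"
  proof -
    \<comment> \<open>Positive weight avoids the exceptional triple, so the edge transports, with
      \<open>\<sigma>\<close> acting as the identity; \<open>input\<close> then recognizes the same
      message.\<close>
    have "transition G' x y ?w"
      using t(1) iso[OF x y codeword_wt_le] w x y by (auto simp: id)
    from input[OF G' this w w G(2)] show ?thesis .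
  qed
  moreover have "?w = ?w'" if w: "0 < ?w'"
  proof -
    have "transition G x y ?w'"
      using t(2) iso[OF x y codeword_wt_le] w x y by (auto simp: id)
    from input[OF G this w w G'(2)] show ?thesis .
  qed
  \<comment> \<open>If neither weight is positive, both are 0.\<close>
  ultimately show ?thesis
    unfolding v_eq by (metis gr0I)
qed

section \<open>Minimal generator matrices\<close>

text \<open>The full-size minors of a single row are its entries.\<close>

lemma constraint_length_one_row:
  assumes "dim_row G = 1"
  shows "constraint_length G = row_degree G 0"
proof -
  have "det (submatrix G UNIV {j}) = G $$ (0, j)" if "j < dim_col G" for j
  proof -
    have "{i. i < dim_col G \<and> i = j} = {j}"
      using that by auto
    then have "submatrix G UNIV {j} \<in> carrier_mat 1 1"
      using assms by (intro carrier_matI) (simp_all add: dim_submatrix)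
    moreover have "submatrix G UNIV {j} $$ (0, 0) = G $$ (0, j)"
      using submatrix_index_card[of 0 G j UNIV "{j}"] assms that by (simp cong: conj_cong)
    ultimately show ?thesis
      by (simp add: det_single)
  qed
  then have "{degree (det (submatrix G UNIV J)) | J. J \<subseteq> {..<dim_col G} \<and> card J = dim_row G} =
      {degree (G $$ (0, j)) | j. j < dim_col G}"
    by (auto simp: assms card_1_singleton_iff) (metis lessThan_iff card_1_singleton_iff One_nat_def empty_subsetI insert_subset)
  then show ?thesis
    by (simp add: constraint_length_def row_degree_def)
qed

lemma minimal_generator_matrix_one_row:
  "generator_matrix 1 n G C \<Longrightarrow> minimal_generator_matrix 1 n G C"
  unfolding minimal_generator_matrix_def generator_matrix_def
  using constraint_length_one_row total_degree_one_row by (metis carrier_matD(1))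

lemma state_ordering_exists: "\<exists>X. state_ordering (G :: 'a :: {field, finite} poly mat) X"
proof -
  let ?V = "carrier_vec (total_degree G) :: 'a vec set"
  have "card {..<num_states G} = card ?V"
    by (simp add: num_states_def card_carrier_vec)
  then obtain h where h: "bij_betw h {..<num_states G} ?V"
    using finite_same_card_bij[of "{..<num_states G}" ?V] by auto
  then obtain a where a: "a < num_states G" "h a = 0\<^sub>v (total_degree G)"
    by (metis bij_betw_def imageE lessThan_iff zero_carrier_vec)
  \<comment> \<open>Index 0 is exchanged with the index of the zero vector.\<close>
  have "bij_betw (h \<circ> transpose 0 a) {..<num_states G} ?V"
    using a num_states_pos[of G] permutes_swap_id[of 0 "{..<num_states G}" a]
    by (intro bij_betw_trans[OF permutes_imp_bij h]) auto
  then show ?thesis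
    using a unfolding state_ordering_def by (intro exI[of _ "h \<circ> transpose 0 a"]) simp
qed

text \<open>\<open>SOME\<close> returns a class of the required kind once one exists, and any
  one-row generator matrix with any state ordering supplies one.\<close>

lemma gen_adjacency_matrix_one_rowE:
  fixes C :: "'a :: {field, finite} fls vec set"
  assumes "convolutional_code 1 n C"
  obtains G X where "generator_matrix 1 n G C" "state_ordering G X"
    "gen_adjacency_matrix 1 n C = perm_class (adjacency_matrix G X)"
proof -
  obtain G where "generator_matrix 1 n G C"
    using assms by (auto simp: convolutional_code_def)
  then have "minimal_generator_matrix 1 n G C"
    by (rule minimal_generator_matrix_one_row)
  moreover obtain X where "state_ordering G X"
    using state_ordering_exists by blast
  ultimately have "\<exists>L G X. minimal_generator_matrix 1 n G C \<and> state_ordering G X \<and>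
      L = perm_class (adjacency_matrix G X)"
    by blast
  from someI_ex[OF this] show thesis
    unfolding gen_adjacency_matrix_def[symmetric]
    by (metis that minimal_generator_matrix_def)
qed

section \<open>From coefficient columns back to polynomial matrices\<close>

lemma degree_le_row_degree: "j < dim_col G \<Longrightarrow> degree (G $$ (i, j)) \<le> row_degree G i"
  unfolding row_degree_def by (intro Max_ge) auto

text \<open>The columns record all coefficients up to the common row degree; beyond it both entries
  have coefficient 0.\<close>

lemma entry_eq_of_coeff_col_eq:
  fixes G G' :: "'a :: field poly mat"
  assumes "coeff_col G j = coeff_col G' j'" "row_degree G 0 = row_degree G' 0"
    and "j < dim_col G" "j' < dim_col G'"
  shows "G $$ (0, j) = G' $$ (0, j')"
proof (rule poly_eqI)
  fix i
  show "coeff (G $$ (0, j)) i = coeff (G' $$ (0, j')) i"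
  proof (cases "i \<le> row_degree G 0")
    case True
    then show ?thesis
      using arg_cong[OF assms(1), of "\<lambda>v :: 'a vec. v $ i"] assms(2) by (simp add: coeff_col_def)
  next
    case False
    then have "degree (G $$ (0, j)) < i" "degree (G' $$ (0, j')) < i"
      using degree_le_row_degree[of j G 0] degree_le_row_degree[of j' G' 0] assms by auto
    then show ?thesis
      by (simp add: coeff_eq_0)
  qed
qed

theorem theorem5p3:
  fixes n :: nat and C C' :: "bit fls vec set"
  assumes "convolutional_code 1 n C"
    and "convolutional_code 1 n C'"
    and "gen_adjacency_matrix 1 n C = gen_adjacency_matrix 1 n C'"
  shows "monomially_equivalent 1 n C C'"
proof -
  obtain G X where gen: "generator_matrix 1 n G C" and X: "state_ordering G X"
    and gam: "gen_adjacency_matrix 1 n C = perm_class (adjacency_matrix G X)"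
    using assms(1) by (rule gen_adjacency_matrix_one_rowE)
  obtain G' X' where gen': "generator_matrix 1 n G' C'" and X': "state_ordering G' X'"
    and gam': "gen_adjacency_matrix 1 n C' = perm_class (adjacency_matrix G' X')"
    using assms(2) by (rule gen_adjacency_matrix_one_rowE)
  have G: "G \<in> carrier_mat 1 n" and G': "G' \<in> carrier_mat 1 n"
    using gen gen' by (auto simp: generator_matrix_def)
  obtain m \<sigma> where m: "row_degree G 0 = m" "row_degree G' 0 = m"
    and \<sigma>: "bij_betw \<sigma> (carrier_vec m) (carrier_vec m)" "\<sigma> (0\<^sub>v m) = 0\<^sub>v m"
      "\<And>x y a. x \<in> carrier_vec m \<Longrightarrow> y \<in> carrier_vec m \<Longrightarrow> a \<le> n \<Longrightarrow>
        \<not> (x = 0\<^sub>v m \<and> y = 0\<^sub>v m \<and> a = 0) \<Longrightarrow> transition G x y a \<longleftrightarrow> transition G' (\<sigma> x) (\<sigma> y) a"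
    using isomorphic_state_graphs[OF G X G' X'] assms(3) unfolding gam gam' by metis
  have wt: "codeword_wt n (coeff_col G) v = codeword_wt n (coeff_col G') v"
    if "v \<in> carrier_vec (Suc m)" for v
    using codeword_wt_eq_of_isomorphic[OF _ m(1) _ m(2) \<sigma> that] G G' by auto
  obtain p where p: "p permutes {..<n}" "\<And>j. j < n \<Longrightarrow> coeff_col G' j = coeff_col G (p j)"
    using permutation_of_codeword_wt_eq[OF _ _ wt] m by (auto simp: coeff_col_def)
  \<comment> \<open>Over the field with two elements the only non-singular diagonal matrix is the
    identity, so the column permutation alone has to carry \<open>G\<close> to
    \<open>G'\<close>.\<close>
  let ?P = "map_mat (\<lambda>c. [:c:]) (perm_mat n p :: bit mat)"
    and ?R = "map_mat (\<lambda>c. [:c:]) (1\<^sub>m n :: bit mat)"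
  have P: "?P = perm_mat n p"
    by (rule map_perm_mat) auto
  have R: "?R = 1\<^sub>m n"
    by (intro eq_matI) auto
  have "G' = G * perm_mat n p"
  proof (rule eq_matI)
    fix i j assume "i < dim_row (G * perm_mat n p)" "j < dim_col (G * perm_mat n p)"
    then have i: "i = 0" and j: "j < n"
      using G by (auto simp: perm_mat_def)
    have "p j < n"
      using p(1) j permutes_in_image by fastforce
    then have "G' $$ (0, j) = G $$ (0, p j)"
      using p(2)[OF j] m G G' j by (intro entry_eq_of_coeff_col_eq) auto
    then show "G' $$ (i, j) = (G * perm_mat n p) $$ (i, j)"
      using mult_perm_mat_index[OF G p(1)] i j by simp
  qed (use G G' in \<open>auto simp: perm_mat_def\<close>)
  then have "G' = G * ?P * ?R"
    unfolding P R using G' by (metis right_mult_one_mat)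
  moreover have "invertible_mat (1\<^sub>m n :: bit mat)"
    unfolding invertible_mat_def inverts_mat_def by (auto intro!: exI[of _ "1\<^sub>m n"])
  moreover have "diagonal_mat (1\<^sub>m n :: bit mat)"
    by (auto simp: diagonal_mat_def)
  moreover have "perm_mat n p \<in> (perm_mats n :: bit mat set)"
    using p(1) by (auto simp: perm_mats_def)
  ultimately have "monomially_equivalent_mats G G'"
    using G unfolding monomially_equivalent_mats_def
    by (intro bexI[of _ "perm_mat n p"] bexI[of _ "1\<^sub>m n"]) auto
  then show ?thesis
    using gen gen' unfolding monomially_equivalent_def by blast
qed

end
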